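(* Suppose $X_1,X_2,\ldots$ are i.i.d. random variables following a continuous distribution on $[0,1]$ with probability density function $f$ and distribution function $F$. Let $N$ be a random variable following a discrete distribution on $\{1,2,\ldots\}$ with probability mass function $\mathbb P(N=n)=p(n)$, $n=1,2,\ldots$. Let $$Y=\max_{1\le i\le N}X_i,\qquad Z=\min_{1\le i\le N}X_i .$$ Then $\mathbb P(Y\le y\mid N=n)=[F(y)]^n$, the conditional density of $Y$ given $N=n$ is $g_Y(y\mid N=n)=n[F(y)]^{n-1}f(y)$, and consequently the (marginal) probability density function of $Y$ is $$g_Y(y)=\sum_{n=1}^\infty g_Y(y\mid N=n)\,\mathbb P(N=n)=f(y)\sum_{n=1}^\infty n\,[F(y)]^{n-1}p(n).$$ Similarly, the probability density function of $Z$ is $$g_Z(z)=f(z)\sum_{n=1}^\infty n\,[1-F(z)]^{n-1}p(n).$$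
   Context: $g_Y$ and $g_Z$ denote the probability density functions of $Y$ and $Z$ respectively.
   Formalization: N is assumed independent of the sequence X_1, X_2, …; without this the claim fails (e.g. X_i uniform, N = 1 if X_1 > 1/2 and N = 2 otherwise). Statements conditional on N = n are made for p(n) > 0. *)

theory Defs
  imports "HOL-Probability.Probability"
begin

(* For sample size 0 these are unspecified (Max {} and Min {}); N is almost surely positive. *)

definition sample_max :: "(nat \<Rightarrow> 'a \<Rightarrow> real) \<Rightarrow> ('a \<Rightarrow> nat) \<Rightarrow> 'a \<Rightarrow> real" where
  "sample_max X N \<omega> = (MAX i\<in>{1..N \<omega>}. X i \<omega>)"

definition sample_min :: "(nat \<Rightarrow> 'a \<Rightarrow> real) \<Rightarrow> ('a \<Rightarrow> nat) \<Rightarrow> 'a \<Rightarrow> real" where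
  "sample_min X N \<omega> = (MIN i\<in>{1..N \<omega>}. X i \<omega>)"

(* Independence of the sigma-algebra generated by N from the one generated by the whole
   sequence (X 1, X 2, ...).  The library's indep_var is not applicable, since it requires both
   random variables to take values in the same type. *)

definition indep_of_sequence ::
    "'a measure \<Rightarrow> ('a \<Rightarrow> nat) \<Rightarrow> (nat \<Rightarrow> 'a \<Rightarrow> real) \<Rightarrow> bool" where
  "indep_of_sequence M N X \<longleftrightarrow>
     prob_space.indep_set M
       (sets (vimage_algebra (space M) N (count_space UNIV)))
       (sets (vimage_algebra (space M) (\<lambda>\<omega>. \<lambda>i\<in>{1..}. X i \<omega>) (Pi\<^sub>M {1..} (\<lambda>_. borel))))"

(* The law of a random variable given the event N = n is its law under this measure. *)

definition given_size :: "'a measure \<Rightarrow> ('a \<Rightarrow> nat) \<Rightarrow> nat \<Rightarrow> 'a measure" where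
  "given_size M N n = uniform_measure M {\<omega> \<in> space M. N \<omega> = n}"

end

theory Submission
  imports Defs
begin

text \<open>Since f is merely measurable, F is not differentiable everywhere, so the density of Y given
  N = n is not obtained by differentiating F^n. Instead, for a finite atomless law \<mu> with
  distribution function F, splitting a square at (y, y) along the diagonal and applying Fubini gives
  F(y)^n as the \<mu>-integral of n F^(n-1) over (-\<infinity>, y], by induction on n. Reflection gives the analogue for the upper
  tail, needed for the minimum. The unconditional densities are the mixtures over the value
  of N.\<close>

section \<open>Powers of a distribution function as integrals\<close>

text \<open>The left side is the product measure of the square \<open>{..y} \<times> {..y}\<close>.
  The diagonal is counted in the part below it, so vertical sections of that part are closed
  half-lines, while horizontal sections of the other part are open ones. Allowing two different
  measures lets the induction below pair \<mu> with a measure having a density with respect to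
  \<mu>.\<close>

lemma emeasure_atMost_mult:
  fixes \<mu> \<nu> :: "real measure"
  assumes "sigma_finite_measure \<mu>" "sigma_finite_measure \<nu>"
    and sets[measurable_cong]: "sets \<mu> = sets borel" "sets \<nu> = sets borel"
  shows "emeasure \<mu> {..y} * emeasure \<nu> {..y} =
    (\<integral>\<^sup>+x\<in>{..y}. emeasure \<nu> {..x} \<partial>\<mu>) + (\<integral>\<^sup>+x\<in>{..y}. emeasure \<mu> {..<x} \<partial>\<nu>)"
proof -
  interpret \<mu>: sigma_finite_measure \<mu> by fact
  interpret \<nu>: sigma_finite_measure \<nu> by fact
  interpret pair_sigma_finite \<mu> \<nu> ..
  have space: "space \<mu> = UNIV" "space \<nu> = UNIV"
    using sets by (auto dest: sets_eq_imp_space_eq)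
  let ?L = "{z :: real \<times> real. snd z \<le> fst z \<and> fst z \<le> y}"
  let ?U = "{z :: real \<times> real. fst z < snd z \<and> snd z \<le> y}"
  have sets_pair: "sets (\<mu> \<Otimes>\<^sub>M \<nu>) = sets (borel \<Otimes>\<^sub>M borel)"
    using sets by (intro sets_pair_measure_cong)
  have "{z \<in> space (borel \<Otimes>\<^sub>M borel). snd z \<le> fst z \<and> fst z \<le> y} \<in> sets (borel \<Otimes>\<^sub>M borel)"
    "{z \<in> space (borel \<Otimes>\<^sub>M borel). fst z < snd z \<and> snd z \<le> y} \<in> sets (borel \<Otimes>\<^sub>M borel)"
    by measurable
  then have L: "?L \<in> sets (\<mu> \<Otimes>\<^sub>M \<nu>)" and U: "?U \<in> sets (\<mu> \<Otimes>\<^sub>M \<nu>)"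
    unfolding sets_pair by (simp_all add: space_pair_measure)
  have "emeasure \<mu> {..y} * emeasure \<nu> {..y} = emeasure (\<mu> \<Otimes>\<^sub>M \<nu>) ({..y} \<times> {..y})"
    using sets by (subst \<nu>.emeasure_pair_measure_Times) auto
  also have "{..y} \<times> {..y} = ?L \<union> ?U"
    by auto
  also have "emeasure (\<mu> \<Otimes>\<^sub>M \<nu>) (?L \<union> ?U) = emeasure (\<mu> \<Otimes>\<^sub>M \<nu>) ?L + emeasure (\<mu> \<Otimes>\<^sub>M \<nu>) ?U"
    using L U by (intro plus_emeasure[symmetric]) auto
  also have "emeasure (\<mu> \<Otimes>\<^sub>M \<nu>) ?L = (\<integral>\<^sup>+x\<in>{..y}. emeasure \<nu> {..x} \<partial>\<mu>)"
    unfolding \<nu>.emeasure_pair_measure_alt[OF L]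
    by (intro nn_integral_cong) (auto simp: indicator_def vimage_def intro!: arg_cong[where f = "emeasure \<nu>"])
  also have "emeasure (\<mu> \<Otimes>\<^sub>M \<nu>) ?U = (\<integral>\<^sup>+x\<in>{..y}. emeasure \<mu> {..<x} \<partial>\<nu>)"
    unfolding emeasure_pair_measure_alt2[OF U]
    by (intro nn_integral_cong) (auto simp: indicator_def vimage_def intro!: arg_cong[where f = "emeasure \<mu>"])
  finally show ?thesis .
qed

lemma borel_measurable_emeasure_atMost:
  fixes \<mu> :: "real measure"
  assumes "finite_measure \<mu>" and sets: "sets \<mu> = sets borel"
  shows "(\<lambda>x. emeasure \<mu> {..x}) \<in> borel_measurable borel"
proof -
  interpret finite_measure \<mu> by fact
  have "mono (\<lambda>x. measure \<mu> {..x})"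
    using sets by (intro monoI finite_measure_mono) auto
  then have [measurable]: "(\<lambda>x. measure \<mu> {..x}) \<in> borel_measurable borel"
    by (rule borel_measurable_mono)
  show ?thesis
    unfolding emeasure_eq_measure by measurable
qed

text \<open>An integrated chain rule for powers of F, with d\<mu> in the place of F'(x) dx. Atoms
  would break it: for a unit point mass at a point up to \<open>y\<close> and \<open>n = 1\<close>
  the integral is 2, but the power is 1.\<close>

lemma nn_integral_power_emeasure_atMost:
  fixes \<mu> :: "real measure"
  assumes "finite_measure \<mu>" and sets[measurable_cong]: "sets \<mu> = sets borel"
    and atomless: "\<And>x. emeasure \<mu> {x} = 0"
  shows "(\<integral>\<^sup>+x\<in>{..y}. of_nat (Suc n) * emeasure \<mu> {..x} ^ n \<partial>\<mu>) = emeasure \<mu> {..y} ^ Suc n"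
proof (induction n arbitrary: y)
  case 0
  then show ?case
    using sets by simp
next
  case (Suc n)
  interpret finite_measure \<mu> by fact
  note [measurable] = borel_measurable_emeasure_atMost[OF assms(1,2)]
  define h where "h x = of_nat (Suc n) * emeasure \<mu> {..x} ^ n" for x
  have [measurable]: "h \<in> borel_measurable borel"
    unfolding h_def by measurable
  \<comment> \<open>By the induction hypothesis \<nu> is the measure whose distribution function is
    the power \<open>Suc n\<close> of that of \<mu>.\<close>
  define \<nu> where "\<nu> = density \<mu> h"
  have sets_\<nu>[measurable_cong]: "sets \<nu> = sets borel"
    unfolding \<nu>_def using sets by simp
  have atMost_\<nu>: "emeasure \<nu> {..x} = emeasure \<mu> {..x} ^ Suc n" for x
    unfolding \<nu>_def using Suc[of x] by (simp add: emeasure_density h_def)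
  have "space \<nu> = UNIV"
    using sets_\<nu> by (auto dest: sets_eq_imp_space_eq)
  moreover have "emeasure \<nu> UNIV = (\<integral>\<^sup>+x. h x \<partial>\<mu>)"
    unfolding \<nu>_def by (subst emeasure_density) auto
  \<comment> \<open>The half-line masses are bounded by the total mass of \<mu>, so h is bounded and
    \<nu> is finite, as Fubini requires.\<close>
  moreover have "(\<integral>\<^sup>+x. h x \<partial>\<mu>) \<le> (\<integral>\<^sup>+x. of_nat (Suc n) * emeasure \<mu> (space \<mu>) ^ n \<partial>\<mu>)"
    unfolding h_def by (intro nn_integral_mono mult_left_mono power_mono emeasure_space) auto
  moreover have "\<dots> < \<infinity>"
    by (simp del: of_nat_Suc add: ennreal_mult_less_top power_less_top_ennreal emeasure_eq_measure of_nat_less_top)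
  ultimately have "finite_measure \<nu>"
    by (intro finite_measureI) auto
  then have sf: "sigma_finite_measure \<nu>"
    by (simp add: finite_measure.sigma_finite_measure)
  \<comment> \<open>Here atomlessness enters: it removes the difference between the open and closed
    half-lines left over from splitting along the diagonal.\<close>
  have lessThan_\<mu>: "emeasure \<mu> {..<x} = emeasure \<mu> {..x}" for x
  proof -
    have "emeasure \<mu> {..x} = emeasure \<mu> ({..<x} \<union> {x})"
      by (rule arg_cong[where f = "emeasure \<mu>"]) auto
    also have "\<dots> = emeasure \<mu> {..<x}"
      using sets atomless by (subst plus_emeasure[symmetric]) auto
    finally show ?thesis by simp
  qed
  have "emeasure \<mu> {..y} ^ Suc (Suc n) = emeasure \<mu> {..y} * emeasure \<nu> {..y}"
    by (simp add: atMost_\<nu>)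
  also have "\<dots> = (\<integral>\<^sup>+x\<in>{..y}. emeasure \<nu> {..x} \<partial>\<mu>) + (\<integral>\<^sup>+x\<in>{..y}. emeasure \<mu> {..<x} \<partial>\<nu>)"
    by (intro emeasure_atMost_mult sf sigma_finite_measure_axioms sets sets_\<nu>)
  also have "(\<integral>\<^sup>+x\<in>{..y}. emeasure \<mu> {..<x} \<partial>\<nu>) = (\<integral>\<^sup>+x\<in>{..y}. h x * emeasure \<mu> {..x} \<partial>\<mu>)"
    unfolding \<nu>_def lessThan_\<mu> by (subst nn_integral_density) (auto simp: mult.assoc)
  \<comment> \<open>With F for the distribution function of \<mu>, the integrands are F^(n+1) and
    (n+1) F^n F, which add up to (n+2) F^(n+1).\<close>
  also have "(\<integral>\<^sup>+x\<in>{..y}. emeasure \<nu> {..x} \<partial>\<mu>) + \<dots> =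
      (\<integral>\<^sup>+x\<in>{..y}. of_nat (Suc (Suc n)) * emeasure \<mu> {..x} ^ Suc n \<partial>\<mu>)"
    by (subst nn_integral_add[symmetric])
      (auto intro!: nn_integral_cong simp: atMost_\<nu> h_def algebra_simps)
  finally show ?case by simp
qed

lemma nn_integral_power_emeasure_atLeast:
  fixes \<mu> :: "real measure"
  assumes "finite_measure \<mu>" and sets[measurable_cong]: "sets \<mu> = sets borel"
    and atomless: "\<And>x. emeasure \<mu> {x} = 0"
  shows "(\<integral>\<^sup>+x\<in>{y..}. of_nat (Suc n) * emeasure \<mu> {x..} ^ n \<partial>\<mu>) = emeasure \<mu> {y..} ^ Suc n"
proof -
  \<comment> \<open>Negation exchanges upper and lower half-lines and creates no atoms.\<close>
  let ?\<mu> = "distr \<mu> borel uminus"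
  have space: "space \<mu> = UNIV"
    using sets by (auto dest: sets_eq_imp_space_eq)
  have fin: "finite_measure ?\<mu>"
    by (intro finite_measure.finite_measure_distr assms) auto
  have vimage: "uminus -` {..x} = {-x..}" "uminus -` {x} = {-x}" for x :: real
    by auto
  have atMost: "emeasure ?\<mu> {..x} = emeasure \<mu> {-x..}" for x
    by (simp add: emeasure_distr space vimage)
  have [measurable]: "(\<lambda>x. emeasure ?\<mu> {..x}) \<in> borel_measurable borel"
    by (intro borel_measurable_emeasure_atMost fin) simp
  have "emeasure \<mu> {y..} ^ Suc n = emeasure ?\<mu> {..-y} ^ Suc n"
    by (simp add: atMost)
  also have "\<dots> = (\<integral>\<^sup>+x\<in>{..-y}. of_nat (Suc n) * emeasure ?\<mu> {..x} ^ n \<partial>?\<mu>)"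
    by (rule nn_integral_power_emeasure_atMost[symmetric])
      (simp_all add: fin emeasure_distr space vimage atomless)
  also have "\<dots> = (\<integral>\<^sup>+x. of_nat (Suc n) * emeasure ?\<mu> {..-x} ^ n * indicator {..-y} (-x) \<partial>\<mu>)"
    by (subst nn_integral_distr) auto
  also have "\<dots> = (\<integral>\<^sup>+x\<in>{y..}. of_nat (Suc n) * emeasure \<mu> {x..} ^ n \<partial>\<mu>)"
    by (intro nn_integral_cong) (auto simp: atMost indicator_def)
  finally show ?thesis by simp
qed


section \<open>Upper tails, and uniqueness of measures from half-lines\<close>

lemma borel_measurable_emeasure_atLeast:
  fixes \<mu> :: "real measure"
  assumes "finite_measure \<mu>" and sets: "sets \<mu> = sets borel"
  shows "(\<lambda>x. emeasure \<mu> {x..}) \<in> borel_measurable borel"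
proof -
  interpret finite_measure \<mu> by fact
  have "mono (\<lambda>x. - measure \<mu> {x..})"
    using sets by (intro monoI le_imp_neg_le finite_measure_mono) auto
  then have "(\<lambda>x. - measure \<mu> {x..}) \<in> borel_measurable borel"
    by (rule borel_measurable_mono)
  then have [measurable]: "(\<lambda>x. measure \<mu> {x..}) \<in> borel_measurable borel"
    by simp
  show ?thesis
    unfolding emeasure_eq_measure by measurable
qed

text \<open>Half-lines in one direction are stable under intersection, generate the Borel sets and
  exhaust the line countably, so the uniqueness theorem for generators applies. Keeping the
  direction as a parameter \<open>S\<close> lets the maximum and the minimum share one argument
  later.\<close>

lemma measure_eqI_halfline:
  fixes \<mu> \<nu> :: "real measure"
  assumes S: "S = atMost \<or> S = atLeast"
    and sets: "sets \<mu> = sets borel" "sets \<nu> = sets borel"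
    and fin: "finite_measure \<mu>"
    and eq: "\<And>y. emeasure \<mu> (S y) = emeasure \<nu> (S y)"
  shows "\<mu> = \<nu>"
proof -
  \<comment> \<open>The exhausting sequence consists of the half-lines ending at i, or of those
    starting at -i, for natural i.\<close>
  obtain A :: "nat \<Rightarrow> real set" where A: "range A \<subseteq> range S" "(\<Union>i. A i) = UNIV"
  proof (cases "S = atMost")
    case True
    then show ?thesis
      using real_arch_simple by (intro that[of "\<lambda>i. S (real i)"]) auto
  next
    case False
    have "\<exists>i. - real i \<le> x" for x
      using real_arch_simple[of "-x"] by (auto simp: minus_le_iff)
    then show ?thesis
      using S False by (intro that[of "\<lambda>i. S (- real i)"]) auto
  qed
  have borel: "sets borel = sigma_sets UNIV (range S)"
    using S
  proof
    assume "S = atMost"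
    then show ?thesis
      by (subst borel_eq_atMost) simp
  next
    assume "S = atLeast"
    then show ?thesis
      by (subst borel_Ici) simp
  qed
  show ?thesis
  proof (rule measure_eqI_generator_eq[OF _ _ _ _ _ A])
    show "Int_stable (range S)"
      using S
    proof
      assume "S = atMost"
      then show ?thesis
        by (auto simp: Int_stable_def)
    next
      assume "S = atLeast"
      moreover have "{a..} \<inter> {b..} = {max a b..}" for a b :: real
        by auto
      ultimately show ?thesis
        by (auto simp: Int_stable_def)
    qed
    show "sets \<mu> = sigma_sets UNIV (range S)" "sets \<nu> = sigma_sets UNIV (range S)"
      using sets borel by auto
    show "emeasure \<mu> (A i) \<noteq> \<infinity>" for i
      using finite_measure.emeasure_finite[OF fin] by simp
  qed (use eq in auto)
qed

section \<open>Conditioning on the sample size\<close>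

text \<open>The two independence assumptions act in turn: that of N from the whole sequence splits
  off the event on N, and that among the X i factorises the rest.\<close>

lemma prob_size_and_sample:
  assumes "prob_space M"
    and indep: "prob_space.indep_vars M (\<lambda>_. borel) X {1..}"
    and N_indep: "indep_of_sequence M N X"
    and "1 \<le> n" and S: "S \<in> sets borel"
  shows "\<P>(\<omega> in M. N \<omega> = n \<and> (\<forall>i\<in>{1..n}. X i \<omega> \<in> S)) =
    \<P>(\<omega> in M. N \<omega> = n) * (\<Prod>i\<in>{1..n}. \<P>(\<omega> in M. X i \<omega> \<in> S))"
proof -
  interpret prob_space M by fact
  let ?PiM = "Pi\<^sub>M {1..} (\<lambda>_. borel) :: (nat \<Rightarrow> real) measure"
  let ?A = "{\<omega> \<in> space M. N \<omega> = n}"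
  let ?B = "{\<omega> \<in> space M. \<forall>i\<in>{1..n}. X i \<omega> \<in> S}"
  have "?A = N -` {n} \<inter> space M"
    by auto
  then have A: "?A \<in> sets (vimage_algebra (space M) N (count_space UNIV))"
    by (simp add: in_vimage_algebra)
  \<comment> \<open>The event on the first n observations is the preimage of a cylinder set, hence
    lies in the sigma-algebra generated by the sequence.\<close>
  have "{x \<in> space ?PiM. \<forall>i\<in>{1..n}. x i \<in> S} \<in> sets ?PiM"
    using S by measurable
  moreover have "?B = (\<lambda>\<omega>. \<lambda>i\<in>{1..}. X i \<omega>) -` {x \<in> space ?PiM. \<forall>i\<in>{1..n}. x i \<in> S} \<inter> space M"
    by (auto simp: space_PiM)
  ultimately have B: "?B \<in> sets (vimage_algebra (space M) (\<lambda>\<omega>. \<lambda>i\<in>{1..}. X i \<omega>) ?PiM)"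
    by (simp only: in_vimage_algebra)
  have "{\<omega> \<in> space M. N \<omega> = n \<and> (\<forall>i\<in>{1..n}. X i \<omega> \<in> S)} = ?A \<inter> ?B"
    by auto
  then have "\<P>(\<omega> in M. N \<omega> = n \<and> (\<forall>i\<in>{1..n}. X i \<omega> \<in> S)) = prob (?A \<inter> ?B)"
    by simp
  also have "\<dots> = prob ?A * prob ?B"
    using N_indep A B unfolding indep_of_sequence_def by (rule indep_setD)
  \<comment> \<open>For an empty index set the intersection would be \<open>UNIV\<close> instead of
    \<open>space M\<close>, so n must be positive.\<close>
  also have "?B = (\<Inter>i\<in>{1..n}. X i -` S \<inter> space M)"
    using \<open>1 \<le> n\<close> by force
  also have "prob \<dots> = (\<Prod>i\<in>{1..n}. prob (X i -` S \<inter> space M))"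
    using \<open>1 \<le> n\<close> S by (intro indep_varsD[OF indep]) auto
  also have "\<dots> = (\<Prod>i\<in>{1..n}. \<P>(\<omega> in M. X i \<omega> \<in> S))"
    by (intro prod.cong arg_cong[where f = prob]) auto
  finally show ?thesis .
qed

text \<open>Links the conditional measure that carries the densities with the elementary conditional
  probability that expresses the distribution function.\<close>

lemma emeasure_given_size:
  assumes "prob_space M" and [measurable]: "N \<in> measurable M (count_space UNIV)" "A \<in> sets M"
    and "\<P>(\<omega> in M. N \<omega> = n) > 0"
  shows "emeasure (given_size M N n) A = ennreal (\<P>(\<omega> in M. \<omega> \<in> A \<bar> N \<omega> = n))"
proof -
  interpret prob_space M by fact
  have "{\<omega> \<in> space M. N \<omega> = n} \<inter> A = {\<omega> \<in> space M. \<omega> \<in> A \<and> N \<omega> = n}"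
    using sets.sets_into_space[OF \<open>A \<in> sets M\<close>] by auto
  then show ?thesis
    using assms(4)
    by (simp add: given_size_def emeasure_uniform_measure emeasure_eq_measure cond_prob_def
      divide_ennreal)
qed

text \<open>The probability of N = n cancels in the quotient. The hypothesis on \<open>T\<close>
  fits both extrema: a maximum lies in a lower half-line, and a minimum in an upper one, exactly
  when all observations do.\<close>

lemma cond_prob_extremum:
  assumes "prob_space M"
    and indep: "prob_space.indep_vars M (\<lambda>_. borel) X {1..}"
    and law: "\<And>i. 1 \<le> i \<Longrightarrow> distr M borel (X i) = \<mu>"
    and N_indep: "indep_of_sequence M N X"
    and n: "1 \<le> n" and pos: "\<P>(\<omega> in M. N \<omega> = n) > 0"
    and S: "S \<in> sets borel"
    and T: "\<And>\<omega>. \<omega> \<in> space M \<Longrightarrow> N \<omega> = n \<Longrightarrow> T \<omega> \<in> S \<longleftrightarrow> (\<forall>i\<in>{1..n}. X i \<omega> \<in> S)"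
  shows "\<P>(\<omega> in M. T \<omega> \<in> S \<bar> N \<omega> = n) = measure \<mu> S ^ n"
proof -
  interpret prob_space M by fact
  have "\<P>(\<omega> in M. X i \<omega> \<in> S) = measure \<mu> S" if "1 \<le> i" for i
  proof -
    have [measurable]: "X i \<in> borel_measurable M"
      using indep that by (auto simp: indep_vars_def2)
    show ?thesis
      unfolding law[OF that, symmetric] using S
      by (subst measure_distr) (auto intro!: arg_cong[where f = prob])
  qed
  moreover have "\<P>(\<omega> in M. T \<omega> \<in> S \<and> N \<omega> = n) = \<P>(\<omega> in M. N \<omega> = n \<and> (\<forall>i\<in>{1..n}. X i \<omega> \<in> S))"
    using T by (intro arg_cong[where f = prob]) auto
  ultimately show ?thesis
    using prob_size_and_sample[OF \<open>prob_space M\<close> indep N_indep n S] pos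
    by (simp add: cond_prob_def)
qed

section \<open>Conditional densities of the extrema\<close>

lemma distributed_distr_borel:
  assumes "distributed M lborel X f"
  shows "distr M borel X = density lborel f"
proof -
  have "distr M borel X = distr M lborel X"
    by (intro distr_cong) auto
  then show ?thesis
    using distributed_distr_eq_density[OF assms] by simp
qed

lemma emeasure_density_lborel_singleton:
  fixes f :: "real \<Rightarrow> ennreal"
  assumes [measurable]: "f \<in> borel_measurable borel"
  shows "emeasure (density lborel f) {x} = 0"
proof -
  have "AE z in lborel. z \<noteq> x"
    by (rule AE_lborel_singleton)
  then have "AE z in lborel. f z * indicator {x} z = 0"
    by eventually_elim simp
  then show ?thesis
    by (simp add: emeasure_density nn_integral_0_iff_AE)
qed

text \<open>On each half-line the conditional law of \<open>T\<close> is the n-th power of the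
  common law, and the integral formula for powers gives the candidate density the same mass.
  Agreement on half-lines then identifies the two measures.\<close>

lemma distributed_given_size_extremum:
  fixes X :: "nat \<Rightarrow> 'a \<Rightarrow> real" and f :: "real \<Rightarrow> ennreal"
  assumes "prob_space M"
    and indep: "prob_space.indep_vars M (\<lambda>_. borel) X {1..}"
    and density: "\<And>i. 1 \<le> i \<Longrightarrow> distributed M lborel (X i) f"
    and N[measurable]: "N \<in> measurable M (count_space UNIV)"
    and N_indep: "indep_of_sequence M N X"
    and n: "1 \<le> n" and pos: "\<P>(\<omega> in M. N \<omega> = n) > 0"
    and S: "S = atMost \<or> S = atLeast"
    and T[measurable]: "T \<in> borel_measurable M"
    and T_iff: "\<And>\<omega> y. \<omega> \<in> space M \<Longrightarrow> N \<omega> = n \<Longrightarrow> T \<omega> \<in> S y \<longleftrightarrow> (\<forall>i\<in>{1..n}. X i \<omega> \<in> S y)"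
  shows "distributed (given_size M N n) lborel T
    (\<lambda>x. f x * (of_nat n * emeasure (density lborel f) (S x) ^ (n - 1)))"
proof -
  interpret prob_space M by fact
  define \<mu> where "\<mu> = density lborel f"
  have [measurable]: "f \<in> borel_measurable borel"
    using distributed_borel_measurable[OF density[of 1]] by simp
  have law: "distr M borel (X i) = \<mu>" if "1 \<le> i" for i
    unfolding \<mu>_def by (intro distributed_distr_borel density that)
  have "X 1 \<in> borel_measurable M"
    using distributed_measurable[OF density[of 1]] by simp
  then have "prob_space \<mu>"
    using law[of 1] prob_space_distr[of "X 1" borel] by simp
  then interpret \<mu>: prob_space \<mu> .
  have sets_\<mu>: "sets \<mu> = sets borel"
    by (simp add: \<mu>_def)
  have atomless: "emeasure \<mu> {x} = 0" for x
    unfolding \<mu>_def by (intro emeasure_density_lborel_singleton) simp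
  have S_borel[measurable]: "S y \<in> sets borel" for y
    using S by auto
  have meas_S[measurable]: "(\<lambda>x. emeasure \<mu> (S x)) \<in> borel_measurable borel"
    using S borel_measurable_emeasure_atMost borel_measurable_emeasure_atLeast
      \<mu>.finite_measure_axioms sets_\<mu> by auto
  define h where "h x = f x * (of_nat n * emeasure \<mu> (S x) ^ (n - 1))" for x
  have [measurable]: "h \<in> borel_measurable borel"
    unfolding h_def by measurable
  have nn_integral_\<mu>: "(\<integral>\<^sup>+x. G x \<partial>\<mu>) = (\<integral>\<^sup>+x. f x * G x \<partial>lborel)" if "G \<in> borel_measurable borel" for G
    unfolding \<mu>_def using that by (subst nn_integral_density) auto
  \<comment> \<open>The power identities are stated for the exponent \<open>Suc k\<close>, which
    makes \<open>n - 1\<close> equal to k.\<close>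
  obtain k where k: "n = Suc k"
    using n by (cases n) auto
  have T_given[measurable]: "T \<in> borel_measurable (given_size M N n)"
    using T by (simp add: given_size_def measurable_cong_sets[OF sets_uniform_measure refl])
  have space_given: "space (given_size M N n) = space M"
    by (simp add: given_size_def)
  have "distr (given_size M N n) borel T = density lborel h"
  proof (rule measure_eqI_halfline[OF S])
    have "prob_space (given_size M N n)"
      unfolding given_size_def using pos
      by (intro prob_space_uniform_measure) (auto simp: emeasure_eq_measure)
    then have "prob_space (distr (given_size M N n) borel T)"
      by (intro prob_space.prob_space_distr) auto
    then show "finite_measure (distr (given_size M N n) borel T)"
      by (rule prob_space.finite_measure)
    fix y
    have "emeasure (distr (given_size M N n) borel T) (S y) =
        emeasure (given_size M N n) {\<omega> \<in> space M. T \<omega> \<in> S y}"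
      by (auto simp: emeasure_distr space_given intro!: arg_cong[where f = "emeasure _"])
    also have "\<dots> = ennreal (\<P>(\<omega> in M. T \<omega> \<in> S y \<bar> N \<omega> = n))"
      using pos by (subst emeasure_given_size[OF \<open>prob_space M\<close> N])
        (auto simp: cond_prob_def intro!: arg_cong[where f = "\<lambda>x. ennreal (prob x / _)"])
    also have "\<dots> = emeasure \<mu> (S y) ^ n"
      by (subst cond_prob_extremum[OF \<open>prob_space M\<close> indep law N_indep n pos S_borel T_iff])
        (auto simp: \<mu>.emeasure_eq_measure ennreal_power)
    also have "\<dots> = (\<integral>\<^sup>+x\<in>S y. of_nat n * emeasure \<mu> (S x) ^ (n - 1) \<partial>\<mu>)"
      using S nn_integral_power_emeasure_atMost[OF \<mu>.finite_measure_axioms sets_\<mu> atomless, of k y]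
        nn_integral_power_emeasure_atLeast[OF \<mu>.finite_measure_axioms sets_\<mu> atomless, of k y]
      by (auto simp: k)
    \<comment> \<open>Passing from \<mu> to Lebesgue measure brings in the factor f.\<close>
    also have "\<dots> = (\<integral>\<^sup>+x\<in>S y. h x \<partial>lborel)"
      by (subst nn_integral_\<mu>) (auto simp: h_def mult.assoc)
    also have "\<dots> = emeasure (density lborel h) (S y)"
      by (simp add: emeasure_density)
    finally show "emeasure (distr (given_size M N n) borel T) (S y) = emeasure (density lborel h) (S y)" .
  qed auto
  moreover have "distr (given_size M N n) lborel T = distr (given_size M N n) borel T"
    by (intro distr_cong) auto
  ultimately have "distributed (given_size M N n) lborel T h"
    unfolding distributed_def by simp
  then show ?thesis
    by (simp only: h_def[abs_def] \<mu>_def)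
qed

section \<open>Mixing over the sample size\<close>

text \<open>The law of total probability. Where N = n has probability zero, \<open>h n\<close> is an
  arbitrary measurable function, as its weight vanishes. The shift to \<open>Suc n\<close> makes the
  series start at sample size 1.\<close>

lemma distributed_mixture:
  assumes "prob_space M" and N[measurable]: "N \<in> measurable M (count_space UNIV)"
    and N_range: "AE \<omega> in M. 1 \<le> N \<omega>"
    and T[measurable]: "T \<in> borel_measurable M"
    and h[measurable]: "\<And>n. h n \<in> borel_measurable lborel"
    and density: "\<And>n. 1 \<le> n \<Longrightarrow> \<P>(\<omega> in M. N \<omega> = n) > 0 \<Longrightarrow>
      distributed (given_size M N n) lborel T (h n)"
  shows "distributed M lborel T (\<lambda>y. \<Sum>n. h (Suc n) y * ennreal (\<P>(\<omega> in M. N \<omega> = Suc n)))"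
proof -
  interpret prob_space M by fact
  let ?N = "\<lambda>n. {\<omega> \<in> space M. N \<omega> = n}"
  let ?g = "\<lambda>y. \<Sum>n. h (Suc n) y * ennreal (prob (?N (Suc n)))"
  have size_part: "emeasure M (?N n \<inter> (T -` A \<inter> space M)) =
      (\<integral>\<^sup>+y. h n y * ennreal (prob (?N n)) * indicator A y \<partial>lborel)"
    if n: "1 \<le> n" and A: "A \<in> sets borel" for n A
  proof (cases "prob (?N n) > 0")
    case True
    have B: "T -` A \<inter> space M \<in> sets M"
      using A by measurable
    have "emeasure (given_size M N n) (T -` A \<inter> space M) =
        emeasure (distr (given_size M N n) lborel T) A"
      using A distributed_measurable[OF density[OF n True]]
      by (subst emeasure_distr) (auto simp: given_size_def)
    also have "\<dots> = (\<integral>\<^sup>+y. h n y * indicator A y \<partial>lborel)"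
      using A by (simp add: distributed_distr_eq_density[OF density[OF n True]] emeasure_density)
    finally have cond: "emeasure M (?N n \<inter> (T -` A \<inter> space M)) / ennreal (prob (?N n)) = \<dots>"
      using B by (simp add: given_size_def emeasure_uniform_measure emeasure_eq_measure)
    \<comment> \<open>Cancellation in \<open>ennreal\<close> needs a divisor that is neither 0 nor
      infinite.\<close>
    have "ennreal (prob (?N n)) / ennreal (prob (?N n)) = 1"
      using True by (intro ennreal_divide_self) auto
    then have "emeasure M (?N n \<inter> (T -` A \<inter> space M)) =
        (\<integral>\<^sup>+y. h n y * indicator A y \<partial>lborel) * ennreal (prob (?N n))"
      by (simp add: ennreal_divide_times flip: cond)
    also have "\<dots> = (\<integral>\<^sup>+y. h n y * ennreal (prob (?N n)) * indicator A y \<partial>lborel)"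
      using A by (subst nn_integral_multc[symmetric]) (auto simp: ac_simps)
    finally show ?thesis .
  \<comment> \<open>For a null event both sides vanish; the product with weight 0 is 0 even where
    \<open>h n\<close> is infinite.\<close>
  next
    case False
    then have 0: "prob (?N n) = 0"
      using measure_nonneg[of M "?N n"] by linarith
    have "emeasure M (?N n \<inter> (T -` A \<inter> space M)) \<le> emeasure M (?N n)"
      by (intro emeasure_mono) auto
    then show ?thesis
      using 0 by (simp add: emeasure_eq_measure)
  qed
  have "distr M lborel T = density lborel ?g"
  proof (rule measure_eqI)
    fix A assume "A \<in> sets (distr M lborel T)"
    then have A[measurable]: "A \<in> sets borel"
      by simp
    have "emeasure (distr M lborel T) A = emeasure M (T -` A \<inter> space M)"
      by (subst emeasure_distr) auto
    \<comment> \<open>The positive values of N cover the event only up to a null set, hence the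
      almost-everywhere comparison.\<close>
    also have "\<dots> = emeasure M (\<Union>n. ?N (Suc n) \<inter> (T -` A \<inter> space M))"
    proof (rule emeasure_eq_AE)
      show "AE \<omega> in M. (\<omega> \<in> T -` A \<inter> space M) = (\<omega> \<in> (\<Union>n. ?N (Suc n) \<inter> (T -` A \<inter> space M)))"
        using N_range by eventually_elim (auto simp: Suc_le_eq gr0_conv_Suc)
    qed auto
    also have "\<dots> = (\<Sum>n. emeasure M (?N (Suc n) \<inter> (T -` A \<inter> space M)))"
      by (intro suminf_emeasure[symmetric]) (auto simp: disjoint_family_on_def)
    also have "\<dots> = (\<Sum>n. \<integral>\<^sup>+y. h (Suc n) y * ennreal (prob (?N (Suc n))) * indicator A y \<partial>lborel)"
      by (simp only: size_part[OF _ A] le_add1 Suc_eq_plus1_left)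
    \<comment> \<open>Monotone convergence swaps sum and integral; the terms are nonnegative, so no
      summability is required.\<close>
    also have "\<dots> = (\<integral>\<^sup>+y. ?g y * indicator A y \<partial>lborel)"
      by (subst nn_integral_suminf[symmetric]) auto
    also have "\<dots> = emeasure (density lborel ?g) A"
      by (subst emeasure_density) auto
    finally show "emeasure (distr M lborel T) A = emeasure (density lborel ?g) A" .
  qed simp
  then show ?thesis
    unfolding distributed_def by simp
qed

(* The series are taken in [0, \<infinity>]: when N has infinite mean they may diverge on the Lebesgue
   null set of points where f is positive although F is 0 or 1. *)

theorem mainTheorem1:
  fixes M :: "'a measure"
    and X :: "nat \<Rightarrow> 'a \<Rightarrow> real"
    and N :: "'a \<Rightarrow> nat"
    and f F :: "real \<Rightarrow> real"
    and p :: "nat \<Rightarrow> real"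
    and Y Z :: "'a \<Rightarrow> real"
  assumes "prob_space M"
    and X_indep: "prob_space.indep_vars M (\<lambda>_. borel) X {1..}"
    and f_nonneg: "\<And>x. 0 \<le> f x"
    and X_density: "\<And>i. 1 \<le> i \<Longrightarrow> distributed M lborel (X i) (\<lambda>x. ennreal (f x))"
    and X_cdf: "\<And>i. 1 \<le> i \<Longrightarrow> cdf (distr M borel (X i)) = F"
    and X_range: "\<And>i. 1 \<le> i \<Longrightarrow> AE \<omega> in M. X i \<omega> \<in> {0..1}"
    and N_measurable: "N \<in> measurable M (count_space UNIV)"
    and N_range: "AE \<omega> in M. 1 \<le> N \<omega>"
    and N_pmf: "\<And>n. 1 \<le> n \<Longrightarrow> \<P>(\<omega> in M. N \<omega> = n) = p n"
    and N_indep: "indep_of_sequence M N X"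
    and Y: "Y = sample_max X N"
    and Z: "Z = sample_min X N"
  shows
    "let g = (\<lambda>(n::nat) y. real n * F y ^ (n - 1) * f y);
         gY = (\<lambda>y. \<Sum>n. ennreal (g (Suc n) y) * ennreal (\<P>(\<omega> in M. N \<omega> = Suc n)))
     in (\<forall>n\<ge>1. p n > 0 \<longrightarrow>
           (\<forall>y. \<P>(\<omega> in M. Y \<omega> \<le> y \<bar> N \<omega> = n) = F y ^ n) \<and>
           distributed (given_size M N n) lborel Y (\<lambda>y. ennreal (g n y))) \<and>
        distributed M lborel Y gY \<and>
        (\<forall>y. gY y = ennreal (f y) * (\<Sum>n. ennreal (real (Suc n) * F y ^ n * p (Suc n)))) \<and>
        distributed M lborel Z
          (\<lambda>z. ennreal (f z) * (\<Sum>n. ennreal (real (Suc n) * (1 - F z) ^ n * p (Suc n))))"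
proof -
  interpret prob_space M by fact
  define \<mu> where "\<mu> = density lborel (\<lambda>x. ennreal (f x))"
  have f[measurable]: "(\<lambda>x. ennreal (f x)) \<in> borel_measurable borel"
    using distributed_borel_measurable[OF X_density[of 1]] by simp
  have X_measurable: "X i \<in> borel_measurable M" if "1 \<le> i" for i
    using distributed_measurable[OF X_density[OF that]] by simp
  have law: "distr M borel (X i) = \<mu>" if "1 \<le> i" for i
    unfolding \<mu>_def by (intro distributed_distr_borel X_density that)
  have "prob_space \<mu>"
    using law[of 1] prob_space_distr[OF X_measurable[of 1]] by simp
  then interpret \<mu>: prob_space \<mu> .
  have \<mu>_space: "space \<mu> = UNIV" and \<mu>_sets: "sets \<mu> = sets borel"
    by (simp_all add: \<mu>_def)
  have F: "F y = measure \<mu> {..y}" for y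
    using X_cdf[of 1] law[of 1] by (auto simp: cdf_def)
  have F_bounds: "0 \<le> F y" "F y \<le> 1" for y
    unfolding F by simp_all
  have F_atMost: "emeasure \<mu> {..y} = ennreal (F y)" for y
    by (simp add: F \<mu>.emeasure_eq_measure)
  \<comment> \<open>A law with a Lebesgue density has no atoms, so the closed upper tail is the
    complement of the closed lower one up to a null set.\<close>
  have F_atLeast: "emeasure \<mu> {y..} = ennreal (1 - F y)" for y
  proof -
    have "emeasure \<mu> {y} = 0"
      unfolding \<mu>_def by (intro emeasure_density_lborel_singleton) simp
    then have "measure \<mu> {y} = 0"
      by (simp add: measure_def)
    moreover have "measure \<mu> {..y} = measure \<mu> {..<y} + measure \<mu> {y}"
      using \<mu>_sets by (subst \<mu>.finite_measure_Union[symmetric]) (auto intro!: arg_cong[where f = \<mu>.prob])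
    moreover have "measure \<mu> {y..} = 1 - measure \<mu> {..<y}"
      using \<mu>_sets \<mu>_space by (subst \<mu>.prob_compl[symmetric]) (auto intro!: arg_cong[where f = \<mu>.prob])
    ultimately show ?thesis
      by (simp add: F \<mu>.emeasure_eq_measure)
  qed
  have F_measurable[measurable]: "F \<in> borel_measurable borel"
    unfolding F[abs_def] using \<mu>_sets by (intro borel_measurable_mono monoI \<mu>.finite_measure_mono) auto
  have f_measurable[measurable]: "f \<in> borel_measurable borel"
    using f_nonneg distributed_real_measurable[OF _ X_density[of 1]] by simp
  have Y_measurable: "Y \<in> borel_measurable M" and Z_measurable: "Z \<in> borel_measurable M"
  proof -
    have "(\<lambda>\<omega>. MAX i\<in>{1..n}. X i \<omega>) \<in> borel_measurable M"
      "(\<lambda>\<omega>. MIN i\<in>{1..n}. X i \<omega>) \<in> borel_measurable M" for n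
      by (auto intro!: borel_measurable_Max borel_measurable_Min X_measurable)
    \<comment> \<open>N takes countably many values, so measurability for each fixed n survives the
      substitution of \<open>N \<omega>\<close> for n.\<close>
    from this[THEN measurable_compose_countable[OF _ N_measurable]]
    show "Y \<in> borel_measurable M" "Z \<in> borel_measurable M"
      unfolding Y Z sample_max_def[abs_def] sample_min_def[abs_def] .
  qed
  \<comment> \<open>A positive n makes the index set nonempty, which avoids the unspecified value of
    \<open>Max {}\<close>; likewise for \<open>Min {}\<close> below.\<close>
  have Y_iff: "Y \<omega> \<in> {..y} \<longleftrightarrow> (\<forall>i\<in>{1..n}. X i \<omega> \<in> {..y})" if "1 \<le> n" "N \<omega> = n" for n \<omega> y
    using that by (auto simp: Y sample_max_def)
  have Z_iff: "Z \<omega> \<in> {y..} \<longleftrightarrow> (\<forall>i\<in>{1..n}. X i \<omega> \<in> {y..})" if "1 \<le> n" "N \<omega> = n" for n \<omega> y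
    using that by (auto simp: Z sample_min_def)
  define g where "g n y = real n * F y ^ (n - 1) * f y" for n y
  \<comment> \<open>The counterpart of \<open>g\<close> for the minimum, with F replaced by the
    upper tail.\<close>
  define k where "k n z = real n * (1 - F z) ^ (n - 1) * f z" for n z
  define gY where "gY y = (\<Sum>n. ennreal (g (Suc n) y) * ennreal (\<P>(\<omega> in M. N \<omega> = Suc n)))" for y
  note measurable_defs = g_def[abs_def] k_def[abs_def]
  have cdf_Y: "\<P>(\<omega> in M. Y \<omega> \<le> y \<bar> N \<omega> = n) = F y ^ n"
    if "1 \<le> n" "\<P>(\<omega> in M. N \<omega> = n) > 0" for n y
    using cond_prob_extremum[OF \<open>prob_space M\<close> X_indep law N_indep that, of "{..y}" Y] Y_iff[OF \<open>1 \<le> n\<close>]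
    by (simp add: F)
  have density_Y: "distributed (given_size M N n) lborel Y (\<lambda>y. ennreal (g n y))"
    if n: "1 \<le> n" "\<P>(\<omega> in M. N \<omega> = n) > 0" for n
  proof -
    have "ennreal (f y) * (of_nat n * emeasure \<mu> {..y} ^ (n - 1)) = ennreal (g n y)" for y
      using f_nonneg F_bounds
      by (simp add: g_def F_atMost ennreal_mult ennreal_power ennreal_of_nat_eq_real_of_nat ac_simps)
    then show ?thesis
      using distributed_given_size_extremum[OF \<open>prob_space M\<close> X_indep X_density N_measurable
        N_indep n disjI1[OF refl] Y_measurable Y_iff[OF n(1)], folded \<mu>_def] by simp
  qed
  have density_Z: "distributed (given_size M N n) lborel Z (\<lambda>z. ennreal (k n z))"
    if n: "1 \<le> n" "\<P>(\<omega> in M. N \<omega> = n) > 0" for n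
  proof -
    have "ennreal (f z) * (of_nat n * emeasure \<mu> {z..} ^ (n - 1)) = ennreal (k n z)" for z
      using f_nonneg F_bounds
      by (simp add: k_def F_atLeast ennreal_mult ennreal_power ennreal_of_nat_eq_real_of_nat ac_simps)
    then show ?thesis
      using distributed_given_size_extremum[OF \<open>prob_space M\<close> X_indep X_density N_measurable
        N_indep n disjI2[OF refl] Z_measurable Z_iff[OF n(1)], folded \<mu>_def] by simp
  qed
  \<comment> \<open>Serves both marginal densities, with c equal to F or to 1 - F at the given
    point.\<close>
  have factor: "(\<Sum>n. ennreal (real (Suc n) * c ^ n * f x) * ennreal (\<P>(\<omega> in M. N \<omega> = Suc n))) =
      ennreal (f x) * (\<Sum>n. ennreal (real (Suc n) * c ^ n * p (Suc n)))" if "0 \<le> c" for c x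
  proof -
    have "ennreal (real (Suc n) * c ^ n * f x) * ennreal (\<P>(\<omega> in M. N \<omega> = Suc n)) =
        ennreal (f x) * ennreal (real (Suc n) * c ^ n * p (Suc n))" for n
    proof -
      \<comment> \<open>Nonnegativity of p is inherited from the probabilities it equals; it is
        needed to merge the products in \<open>ennreal\<close> into one real product.\<close>
      have "p (Suc n) = \<P>(\<omega> in M. N \<omega> = Suc n)"
        by (simp add: N_pmf)
      moreover have "0 \<le> p (Suc n)"
        unfolding calculation by simp
      ultimately show ?thesis
        using that f_nonneg[of x] by (simp add: ac_simps flip: ennreal_mult)
    qed
    then show ?thesis
      by simp
  qed
  have "distributed M lborel Y gY"
    unfolding gY_def[abs_def]
    by (rule distributed_mixture[OF \<open>prob_space M\<close> N_measurable N_range Y_measurable _ density_Y])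
      (simp_all add: measurable_defs)
  moreover have "gY y = ennreal (f y) * (\<Sum>n. ennreal (real (Suc n) * F y ^ n * p (Suc n)))" for y
    using factor[OF F_bounds(1)[of y], of y] by (simp add: gY_def g_def)
  moreover have "distributed M lborel Z
      (\<lambda>y. \<Sum>n. ennreal (k (Suc n) y) * ennreal (\<P>(\<omega> in M. N \<omega> = Suc n)))"
    by (rule distributed_mixture[OF \<open>prob_space M\<close> N_measurable N_range Z_measurable _ density_Z])
      (simp_all add: measurable_defs)
  moreover have "(\<Sum>n. ennreal (k (Suc n) z) * ennreal (\<P>(\<omega> in M. N \<omega> = Suc n))) =
      ennreal (f z) * (\<Sum>n. ennreal (real (Suc n) * (1 - F z) ^ n * p (Suc n)))" for z
    using factor[of "1 - F z" z] F_bounds[of z] by (simp add: k_def)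
  ultimately show ?thesis
    using cdf_Y density_Y N_pmf unfolding Let_def gY_def[abs_def] g_def[abs_def] by simp
qed

end
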